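(* Every forest-connected RIS architecture is planar-connected. That is, if the graph $\mathcal{G}_N$ associated with the architecture is acyclic for every admissible number of RIS elements $N$, then $\mathcal{G}_N$ is a planar graph for every admissible $N$. In particular, the single-connected RIS and every tree-connected RIS, which are special cases of forest-connected RIS, are planar-connected.
   Context: An $N$-element beyond-diagonal reconfigurable intelligent surface (BD-RIS) is represented by a finite simple undirected graph $\mathcal{G}=\mathcal{G}_N=(\mathcal{V},\mathcal{E})$ with vertex set $\mathcal{V}=\{v_1,\ldots,v_N\}$ (one vertex per RIS element), where $v_n$ and $v_m$ ($n\neq m$) are joined by an edge if and only if a tunable admittance component interconnects elements $n$ and $m$. A BD-RIS architecture is a rule assigning such a graph $\mathcal{G}_N$ to each admissible number of elements $N$. A graph is planar if it can be drawn in the plane with no edges crossing. A BD-RIS architecture is planar-connected if its associated graph $\mathcal{G}_N$ is planar for any (admissible) number of RIS elements $N$. A forest-connected RIS is an architecture whose graph is acyclic (a forest) for every admissible $N$. The single-connected RIS is the architecture whose graph has no edges. A tree-connected RIS is an architecture whose graph is a tree (connected and acyclic) on the $N$ vertices. *)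

theory Defs
  imports "HOL-Analysis.Analysis" "Graph_Theory.Graph_Theory"
begin

text \<open>
  A finite simple undirected graph is a \<^term>\<open>pair_graph\<close>: a finite vertex set with a
  symmetric irreflexive adjacency relation, each undirected edge \<open>{u, v}\<close> being the pair of
  arcs \<open>(u, v)\<close>, \<open>(v, u)\<close>. In this encoding \<^term>\<open>pre_digraph.cycle\<close> also
  accepts the walk \<open>u, v, u\<close> along a single edge, so that \<^const>\<open>forest\<close> and
  \<^const>\<open>tree\<close> fail for every graph with an edge. The cycles of the undirected graph are
  the cycles with at least three arcs.
\<close>

definition acyclic_graph :: "'a pair_pre_digraph \<Rightarrow> bool" where
  "acyclic_graph G \<longleftrightarrow>
     \<not> (\<exists>p. pre_digraph.cycle (with_proj G) p \<and> 3 \<le> length p)"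

definition tree_graph :: "'a pair_pre_digraph \<Rightarrow> bool" where
  "tree_graph G \<longleftrightarrow> Digraph_Component.connected (with_proj G) \<and> acyclic_graph G"

text \<open>
  In a drawing, \<open>f\<close> places the vertices and \<open>\<gamma> {u, v}\<close> is the single curve
  drawn for the edge \<open>{u, v}\<close>, in either orientation. A curve passes through no vertex other
  than its two ends, and the curves of distinct edges meet at most in a common end vertex.
\<close>

definition plane_drawing ::
    "'a pair_pre_digraph \<Rightarrow> ('a \<Rightarrow> real ^ 2) \<Rightarrow> ('a set \<Rightarrow> real \<Rightarrow> real ^ 2) \<Rightarrow> bool" where
  "plane_drawing G f \<gamma> \<longleftrightarrow>
     inj_on f (pverts G) \<and>
     (\<forall>(u, v) \<in> parcs G.
        Path_Connected.arc (\<gamma> {u, v}) \<and>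
        {pathstart (\<gamma> {u, v}), pathfinish (\<gamma> {u, v})} = {f u, f v} \<and>
        path_image (\<gamma> {u, v}) \<inter> f ` pverts G = {f u, f v}) \<and>
     (\<forall>(u, v) \<in> parcs G. \<forall>(x, y) \<in> parcs G. {u, v} \<noteq> {x, y} \<longrightarrow>
        path_image (\<gamma> {u, v}) \<inter> path_image (\<gamma> {x, y}) \<subseteq> f ` ({u, v} \<inter> {x, y}))"

definition planar_graph :: "'a pair_pre_digraph \<Rightarrow> bool" where
  "planar_graph G \<longleftrightarrow> (\<exists>f \<gamma>. plane_drawing G f \<gamma>)"

text \<open>
  The number \<open>n\<close> stands for the vertex \<open>v\<^sub>n\<close>, that is, for the \<open>n\<close>-th RIS element. The value
  of \<open>ris_graph\<close> at a non-admissible number is irrelevant.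
\<close>

record bd_ris =
  admissible :: "nat set"
  ris_graph :: "nat \<Rightarrow> nat pair_pre_digraph"

definition bd_ris_architecture :: "bd_ris \<Rightarrow> bool" where
  "bd_ris_architecture R \<longleftrightarrow>
     (\<forall>N \<in> admissible R. 1 \<le> N \<and> pair_graph (ris_graph R N) \<and> pverts (ris_graph R N) = {1..N})"

definition planar_connected :: "bd_ris \<Rightarrow> bool" where
  "planar_connected R \<longleftrightarrow> (\<forall>N \<in> admissible R. planar_graph (ris_graph R N))"

definition forest_connected :: "bd_ris \<Rightarrow> bool" where
  "forest_connected R \<longleftrightarrow> (\<forall>N \<in> admissible R. acyclic_graph (ris_graph R N))"

definition single_connected :: "bd_ris \<Rightarrow> bool" where
  "single_connected R \<longleftrightarrow> (\<forall>N \<in> admissible R. parcs (ris_graph R N) = {})"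

definition tree_connected :: "bd_ris \<Rightarrow> bool" where
  "tree_connected R \<longleftrightarrow> (\<forall>N \<in> admissible R. tree_graph (ris_graph R N))"

end

theory Submission
  imports Defs
begin

text \<open>
  A finite forest has a vertex with at most one neighbour, namely the end of a longest path.
  Delete it, draw the remaining forest with straight segments by induction, and put the deleted
  vertex back close to the point \<open>a\<close> of its neighbour, off the lines spanned by the segments
  leaving \<open>a\<close>: the new segment then meets the old drawing in \<open>a\<close> only.
\<close>

section \<open>Leaves of finite forests\<close>

text \<open>By maximality, every neighbour of the start of a longest path lies on that path, and a
  neighbour beyond the second vertex would close a cycle. Nothing else is claimed about
  \<open>u\<close>, so an isolated \<open>v\<close> is covered too.\<close>

lemma (in pair_graph) leaf_exists:
  assumes acyc: "acyclic_graph G" and ne: "pverts G \<noteq> {}"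
  obtains v u where "v \<in> pverts G" and "\<And>w. (v, w) \<in> parcs G \<Longrightarrow> w = u"
proof -
  obtain a where "a \<in> pverts G"
    using ne by blast
  then have "\<exists>u v. apath u [] v"
    by (auto simp: apath_Nil_iff)
  moreover have "\<forall>p. (\<exists>u v. apath u p v) \<longrightarrow> length p < card (pverts G)"
    using length_apath_less by blast
  ultimately have "\<exists>p. (\<exists>u v. apath u p v) \<and> (\<forall>r. (\<exists>x y. apath x r y) \<longrightarrow> length r \<le> length p)"
    by (rule ex_has_greatest_nat[where P = "\<lambda>p. \<exists>u v. apath u p v" and f = length])
  then obtain p where "\<exists>u v. apath u p v"
      and longest': "\<forall>r. (\<exists>x y. apath x r y) \<longrightarrow> length r \<le> length p"
    by blast
  then obtain u v where path: "apath u p v"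
    by blast
  have longest: "length r \<le> length p" if "apath x r y" for x r y
    using longest' that by blast
  have "u \<in> pverts G"
    using path by (auto simp: apath_def)
  \<comment> \<open>\<open>snd (hd p)\<close> is the second vertex of the path. If
    \<open>p = []\<close>, it is unspecified, but then no arc \<open>(u, w)\<close> exists, since it
    would give a longer path.\<close>
  moreover have "w = snd (hd p)" if uw: "(u, w) \<in> parcs G" for w
  proof -
    have wu: "(w, u) \<in> parcs G" and "w \<noteq> u"
      using uw arcs_symmetric no_loops' by auto
    have "w \<in> set (pawalk_verts u p)"
    proof (rule ccontr)
      assume "w \<notin> set (pawalk_verts u p)"
      then have "apath w ((w, u) # p) v"
        using path wu by (simp add: apath_Cons_iff)
      then show False
        using longest by fastforce
    qed
    then obtain q r where pqr: "p = q @ r" and q: "awalk u q w"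
      using path awalk_decomp[of u p v w] by (auto simp: apath_def)
    have "distinct (pawalk_verts u q)"
      using path awalk_verts_append[of u q r v] unfolding apath_def pqr by auto
    then have "cycle ((w, u) # q)"
      using q wu unfolding cycle_def by (auto simp: awalk_Cons_iff intro!: exI[of _ w])
    \<comment> \<open>The closed walk has \<open>length q + 1\<close> arcs. Length two, the walk
      back and forth along one edge, is not excluded by \<open>acyclic_graph\<close>; it is the case
      where \<open>w\<close> is the second vertex.\<close>
    then have "length q < 2"
      using acyc unfolding acyclic_graph_def by (auto simp: not_le)
    moreover have "q \<noteq> []"
      using q \<open>w \<noteq> u\<close> by (auto simp: awalk_Nil_iff)
    ultimately obtain e where "q = [e]"
      by (cases q) auto
    then show ?thesis
      using q pqr by (auto simp: awalk_Cons_iff awalk_Nil_iff)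
  qed
  ultimately show thesis
    using that by blast
qed

definition delete_vertex :: "'a \<Rightarrow> 'a pair_pre_digraph \<Rightarrow> 'a pair_pre_digraph" where
  "delete_vertex v G =
     \<lparr>pverts = pverts G - {v}, parcs = {e \<in> parcs G. fst e \<noteq> v \<and> snd e \<noteq> v}\<rparr>"

lemma delete_vertex_simps [simp]:
  "pverts (delete_vertex v G) = pverts G - {v}"
  "parcs (delete_vertex v G) = {e \<in> parcs G. fst e \<noteq> v \<and> snd e \<noteq> v}"
  by (simp_all add: delete_vertex_def)

lemma (in pair_graph) pair_graph_delete_vertex: "pair_graph (delete_vertex v G)"
proof unfold_locales
  have "sym (parcs G)"
    using arcs_symmetric by (auto intro: symI)
  then show "symmetric (with_proj (delete_vertex v G))"
    by (auto simp: symmetric_def sym_def)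
qed (use wellformed no_loops finite_verts finite_arcs in auto)

lemma (in pair_graph) acyclic_delete_vertex:
  assumes "acyclic_graph G"
  shows "acyclic_graph (delete_vertex v G)"
proof -
  interpret H: pair_graph "delete_vertex v G"
    by (rule pair_graph_delete_vertex)
  have "subgraph (with_proj (delete_vertex v G)) (with_proj G)"
    by (rule subgraphI) (auto simp: compatible_def intro: H.wf_digraph_axioms wf_digraph_axioms)
  then show ?thesis
    using assms subgraph_cycle unfolding acyclic_graph_def by blast
qed

section \<open>Straight-line drawings\<close>

text \<open>This is \<open>plane_drawing\<close> for segments, with \<open>f\<close> as the only
  data. In a graph without loops, injectivity of \<open>f\<close> makes each segment an arc with the
  right ends.\<close>

definition straight_drawing :: "'a pair_pre_digraph \<Rightarrow> ('a \<Rightarrow> real ^ 2) \<Rightarrow> bool" where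
  "straight_drawing G f \<longleftrightarrow>
     inj_on f (pverts G) \<and>
     (\<forall>(u, v) \<in> parcs G. closed_segment (f u) (f v) \<inter> f ` pverts G = {f u, f v}) \<and>
     (\<forall>(u, v) \<in> parcs G. \<forall>(x, y) \<in> parcs G. {u, v} \<noteq> {x, y} \<longrightarrow>
        closed_segment (f u) (f v) \<inter> closed_segment (f x) (f y) \<subseteq> f ` ({u, v} \<inter> {x, y}))"

lemma (in pair_graph) straight_drawing_imp_planar:
  assumes "straight_drawing G f"
  shows "planar_graph G"
proof -
  \<comment> \<open>A curve is indexed by an unordered edge, but \<open>linepath\<close> needs a
    direction. The choice fixes one of the two, and the facts below hold for either.\<close>
  define \<gamma> where "\<gamma> e = (let (u, v) = SOME (u, v). e = {u, v} in linepath (f u) (f v))" for e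
  have \<gamma>: "\<gamma> {u, v} = linepath (f u) (f v) \<or> \<gamma> {u, v} = linepath (f v) (f u)" for u v
  proof -
    have "case SOME (x, y). {u, v} = {x, y} of (x, y) \<Rightarrow> {u, v} = {x, y}"
      by (rule someI[of _ "(u, v)"]) simp
    then show ?thesis
      by (auto simp: \<gamma>_def Let_def doubleton_eq_iff split: prod.splits)
  qed
  have image: "path_image (\<gamma> {u, v}) = closed_segment (f u) (f v)" for u v
    using \<gamma>[of u v] by (auto simp: closed_segment_commute)
  have ends: "{pathstart (\<gamma> {u, v}), pathfinish (\<gamma> {u, v})} = {f u, f v}" for u v
    using \<gamma>[of u v] by auto
  have arc: "Path_Connected.arc (\<gamma> {u, v})" if "(u, v) \<in> parcs G" for u v
  proof -
    have "f u \<noteq> f v"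
      using that assms wellformed[OF that] no_loops'[OF that]
      by (auto simp: straight_drawing_def dest: inj_onD)
    then show ?thesis
      using \<gamma>[of u v] by auto
  qed
  have "plane_drawing G f \<gamma>"
    using assms arc unfolding plane_drawing_def straight_drawing_def image ends by fast
  then show ?thesis
    by (auto simp: planar_graph_def)
qed

section \<open>Adding a leaf to a drawing\<close>

text \<open>Finitely many lines through \<open>a\<close> have measure zero, so they cannot cover a
  ball around \<open>a\<close> that misses \<open>S\<close>. Any point of the ball off these lines
  serves as \<open>p\<close>.\<close>

lemma segment_leaving_point:
  fixes a :: "real ^ 2"
  assumes "finite W" and "closed S" and "a \<notin> S"
  obtains p where "p \<noteq> a" and "closed_segment a p \<inter> S = {}"
    and "\<And>w. w \<in> W \<Longrightarrow> w \<noteq> a \<Longrightarrow> closed_segment a p \<inter> closed_segment a w = {a}"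
proof -
  obtain \<epsilon> where "\<epsilon> > 0" and "ball a \<epsilon> \<subseteq> - S"
    using assms(2,3) openE[of "- S" a] by (auto simp: open_Compl)
  then have \<epsilon>: "ball a \<epsilon> \<inter> S = {}"
    by blast
  have "negligible (affine hull {a, w})" for w :: "real ^ 2"
  proof -
    have "card {a, w} \<le> DIM(real ^ 2)"
      using card_insert_le_m1[of 2 "{w}" a] by simp
    then show ?thesis
      by (simp add: negligible_convex_interior affine_imp_convex empty_interior_affine_hull)
  qed
  \<comment> \<open>Inserting \<open>a\<close> adds the degenerate hull \<open>{a}\<close>, which
    forces \<open>p \<noteq> a\<close> even if \<open>W\<close> is empty.\<close>
  then have "negligible (\<Union>w \<in> insert a W. affine hull {a, w})"
    using assms(1) by blast
  moreover have "\<not> negligible (ball a \<epsilon>)"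
    using \<open>\<epsilon> > 0\<close> by (simp add: open_not_negligible)
  ultimately have "\<not> ball a \<epsilon> \<subseteq> (\<Union>w \<in> insert a W. affine hull {a, w})"
    using negligible_subset by metis
  then obtain p where p: "p \<in> ball a \<epsilon>"
      and off: "\<And>w. w \<in> insert a W \<Longrightarrow> p \<notin> affine hull {a, w}"
    by blast
  have "closed_segment a p \<subseteq> ball a \<epsilon>"
    using p \<open>\<epsilon> > 0\<close> by (simp add: closed_segment_subset)
  moreover have "closed_segment a p \<inter> closed_segment a w = {a}" if "w \<in> W" "w \<noteq> a" for w
  proof -
    have "\<not> collinear {a, w, p}"
      using that off[of w] collinear_3_affine_hull[of a w p] by auto
    then have "\<not> collinear {p, a, w}"
      by (simp add: insert_commute)
    then show ?thesis
      using Int_closed_segment[of a p w] by (simp add: closed_segment_commute)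
  qed
  moreover have "p \<noteq> a"
    using off[of a] by auto
  ultimately show thesis
    using that \<epsilon> by blast
qed

text \<open>Here \<open>p\<close> is the position for a new leaf at \<open>u\<close>. The edges at
  \<open>u\<close> are avoided by direction, everything else by distance.\<close>

lemma (in pair_graph) straight_drawing_new_leaf:
  assumes f: "straight_drawing G f" and u: "u \<in> pverts G"
  obtains p where "closed_segment (f u) p \<inter> f ` pverts G = {f u}" and "p \<notin> f ` pverts G"
    and "\<And>x y. (x, y) \<in> parcs G \<Longrightarrow>
           closed_segment (f u) p \<inter> closed_segment (f x) (f y) \<subseteq> f ` ({u} \<inter> {x, y})"
    and "\<And>x y. (x, y) \<in> parcs G \<Longrightarrow> p \<notin> closed_segment (f x) (f y)"
proof -
  have inj: "inj_on f (pverts G)"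
    using f by (simp add: straight_drawing_def)
  have f_eq: "f u = f x \<longleftrightarrow> u = x" if "x \<in> pverts G" for x
    using inj u that by (auto dest: inj_onD)
  define E where "E = {(x, y) \<in> parcs G. x \<noteq> u \<and> y \<noteq> u}"
  \<comment> \<open>\<open>S\<close> is the part of the drawing at positive distance from
    \<open>f u\<close>: the other vertices and the edges not incident with \<open>u\<close>, none of
    which passes through \<open>f u\<close>.\<close>
  define S where "S = f ` (pverts G - {u}) \<union> (\<Union>(x, y) \<in> E. closed_segment (f x) (f y))"
  have "finite E"
    unfolding E_def using finite_arcs by (auto intro: finite_subset)
  then have "closed S"
    unfolding S_def using finite_verts
    by (intro closed_Un closed_UN) (auto intro: finite_imp_closed)
  moreover have "f u \<notin> S"
  proof -
    have "f u \<notin> closed_segment (f x) (f y)" if "(x, y) \<in> E" for x y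
    proof -
      have "(x, y) \<in> parcs G" "x \<noteq> u" "y \<noteq> u"
        using that by (auto simp: E_def)
      moreover from this have "closed_segment (f x) (f y) \<inter> f ` pverts G = {f x, f y}"
        using f unfolding straight_drawing_def by blast
      ultimately show ?thesis
        using f_eq u wellformed'[of x y] by blast
    qed
    then show ?thesis
      using f_eq by (auto simp: S_def)
  qed
  ultimately obtain p where "p \<noteq> f u" and S: "closed_segment (f u) p \<inter> S = {}"
      and W: "\<And>w. w \<in> f ` pverts G \<Longrightarrow> w \<noteq> f u \<Longrightarrow>
                closed_segment (f u) p \<inter> closed_segment (f u) w = {f u}"
    using segment_leaving_point[of "f ` pverts G" S "f u"] finite_verts by auto
  have vertices: "closed_segment (f u) p \<inter> f ` pverts G = {f u}"
    using S u by (auto simp: S_def)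
  then have "p \<notin> f ` pverts G"
    using \<open>p \<noteq> f u\<close> by auto
  moreover have edges: "closed_segment (f u) p \<inter> closed_segment (f x) (f y) \<subseteq> f ` ({u} \<inter> {x, y})"
    if xy: "(x, y) \<in> parcs G" for x y
  proof -
    have V: "x \<in> pverts G" "y \<in> pverts G" "x \<noteq> y"
      using xy wellformed'[OF xy] no_loops'[OF xy] by auto
    consider "x = u" | "y = u" | "(x, y) \<in> E"
      using xy by (auto simp: E_def)
    then show ?thesis
    proof cases
      case 1
      then show ?thesis
        using W[of "f y"] V f_eq[of y] by auto
    next
      case 2
      then show ?thesis
        using W[of "f x"] V f_eq[of x] by (auto simp: closed_segment_commute[of "f x"])
    next
      case 3
      then have "closed_segment (f x) (f y) \<subseteq> S"
        by (auto simp: S_def)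
      then show ?thesis
        using S by blast
    qed
  qed
  \<comment> \<open>As an end of the new segment, \<open>p\<close> could lie on an old edge only if
    it were \<open>f u\<close>.\<close>
  moreover have "p \<notin> closed_segment (f x) (f y)" if "(x, y) \<in> parcs G" for x y
    using edges[OF that] \<open>p \<noteq> f u\<close> by auto
  ultimately show thesis
    using vertices that by blast
qed

text \<open>Straightness strengthens the induction hypothesis: arbitrary arcs may spiral around a
  vertex and block every segment leaving it.\<close>

lemma straight_drawing_exists:
  assumes "pair_graph G" and "acyclic_graph G"
  shows "\<exists>f. straight_drawing G f"
  using assms
proof (induction "card (pverts G)" arbitrary: G rule: less_induct)
  case less
  interpret pair_graph G
    by fact
  show ?case
  \<comment> \<open>With at most one vertex as the base case, the other case always offers a vertex
    besides the leaf, even if the leaf is isolated.\<close>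
  proof (cases "\<exists>v. pverts G \<subseteq> {v}")
    case True
    then have "(x, y) \<notin> parcs G" for x y
      using wellformed'[of x y] no_loops'[of x y] by auto
    then have "parcs G = {}"
      by auto
    moreover have "inj_on f (pverts G)" for f :: "'a \<Rightarrow> real ^ 2"
      using True by (auto simp: inj_on_def)
    ultimately show ?thesis
      by (auto simp: straight_drawing_def)
  next
    case False
    then obtain v u' where v: "v \<in> pverts G" and u': "\<And>w. (v, w) \<in> parcs G \<Longrightarrow> w = u'"
      using leaf_exists[OF less.prems(2)] by blast
    \<comment> \<open>An isolated vertex is placed next to an arbitrary vertex \<open>u\<close>.\<close>
    obtain u where u: "u \<in> pverts G" "u \<noteq> v" and leaf: "\<And>w. (v, w) \<in> parcs G \<Longrightarrow> w = u"
    proof (cases "\<exists>w. (v, w) \<in> parcs G")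
      case True
      then show thesis
        using that[of u'] u' wellformed'(2) no_loops' by blast
    next
      case no_arc: False
      then show thesis
        using that False by blast
    qed
    define H where "H = delete_vertex v G"
    interpret H: pair_graph H
      unfolding H_def by (rule pair_graph_delete_vertex)
    have "card (pverts H) < card (pverts G)"
      unfolding H_def delete_vertex_simps by (rule card_Diff1_less[OF finite_verts v])
    then obtain f where f: "straight_drawing H f"
      using less.hyps[of H] H.pair_graph acyclic_delete_vertex[OF less.prems(2)] by (auto simp: H_def)
    obtain p where p: "closed_segment (f u) p \<inter> f ` pverts H = {f u}" "p \<notin> f ` pverts H"
        "\<And>x y. (x, y) \<in> parcs H \<Longrightarrow>
           closed_segment (f u) p \<inter> closed_segment (f x) (f y) \<subseteq> f ` ({u} \<inter> {x, y})"
        "\<And>x y. (x, y) \<in> parcs H \<Longrightarrow> p \<notin> closed_segment (f x) (f y)"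
      using H.straight_drawing_new_leaf[OF f, of u] u by (auto simp: H_def)
    define g where "g = f(v := p)"
    have g: "g v = p" "\<And>x. x \<noteq> v \<Longrightarrow> g x = f x"
      by (simp_all add: g_def)
    have image_g: "g ` pverts G = insert p (f ` pverts H)"
      using v by (auto simp: g_def H_def)
    have arcs: "(x, y) \<in> parcs H \<and> x \<noteq> v \<and> y \<noteq> v \<or> x = v \<and> y = u \<or> x = u \<and> y = v"
      if "(x, y) \<in> parcs G" for x y
      using that leaf arcs_symmetric[OF that] by (auto simp: H_def)
    have inj: "inj_on g (pverts G)"
      using f p(2) v unfolding straight_drawing_def H_def g_def inj_on_def by auto
    have old: "closed_segment (f x) (f y) \<inter> f ` pverts H = {f x, f y}" if "(x, y) \<in> parcs H" for x y
      using f that unfolding straight_drawing_def by blast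
    have vertices: "closed_segment (g x) (g y) \<inter> g ` pverts G = {g x, g y}"
      if xy: "(x, y) \<in> parcs G" for x y
      using arcs[OF xy]
    proof (elim disjE conjE)
      assume "(x, y) \<in> parcs H" "x \<noteq> v" "y \<noteq> v"
      then show ?thesis
        using old[of x y] p(4)[of x y] by (simp add: image_g g)
    next
      assume "x = v" "y = u"
      then show ?thesis
        using p(1) u by (auto simp: image_g g closed_segment_commute[of p])
    next
      assume "x = u" "y = v"
      then show ?thesis
        using p(1) u by (auto simp: image_g g)
    qed
    \<comment> \<open>An old edge avoids \<open>v\<close>, so \<open>{u, v} \<inter> {x, y}\<close>
      equals \<open>{u} \<inter> {x, y}\<close>, where \<open>g\<close> and \<open>f\<close>
      agree.\<close>
    have new: "closed_segment (g u) (g v) \<inter> closed_segment (g x) (g y) \<subseteq> g ` ({u, v} \<inter> {x, y})"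
      if "(x, y) \<in> parcs H" "x \<noteq> v" "y \<noteq> v" for x y
      using p(3)[of x y] that u(2) by (simp add: g) (auto simp: g)
    have edges: "closed_segment (g a) (g b) \<inter> closed_segment (g x) (g y) \<subseteq> g ` ({a, b} \<inter> {x, y})"
      if ab: "(a, b) \<in> parcs G" and xy: "(x, y) \<in> parcs G" and ne: "{a, b} \<noteq> {x, y}" for a b x y
    proof -
      have old_old: ?thesis if "(a, b) \<in> parcs H" "(x, y) \<in> parcs H" "a \<noteq> v" "b \<noteq> v" "x \<noteq> v" "y \<noteq> v"
      proof -
        have "closed_segment (f a) (f b) \<inter> closed_segment (f x) (f y) \<subseteq> f ` ({a, b} \<inter> {x, y})"
          using f that(1,2) ne unfolding straight_drawing_def by blast
        moreover have "g ` ({a, b} \<inter> {x, y}) = f ` ({a, b} \<inter> {x, y})"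
          using that(3-6) by (intro image_cong) (auto simp: g)
        ultimately show ?thesis
          using that(3-6) by (simp add: g)
      qed
      have new_old: ?thesis if "{a, b} = {u, v}" "(x, y) \<in> parcs H" "x \<noteq> v" "y \<noteq> v"
      proof -
        have seg: "closed_segment (g a) (g b) = closed_segment (g u) (g v)"
          using that(1) by (auto simp: doubleton_eq_iff closed_segment_commute)
        show ?thesis
          unfolding seg that(1) by (rule new[OF that(2-4)])
      qed
      have old_new: ?thesis if "{x, y} = {u, v}" "(a, b) \<in> parcs H" "a \<noteq> v" "b \<noteq> v"
      proof -
        have seg: "closed_segment (g x) (g y) = closed_segment (g u) (g v)"
          using that(1) by (auto simp: doubleton_eq_iff closed_segment_commute)
        show ?thesis
          unfolding seg that(1) using new[OF that(2-4)] by (simp only: Int_commute)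
      qed
      \<comment> \<open>Every edge is old or equals \<open>{u, v}\<close>, and distinct edges cannot
        both be \<open>{u, v}\<close>; so the three cases above suffice.\<close>
      have "(a, b) \<in> parcs H \<and> a \<noteq> v \<and> b \<noteq> v \<or> {a, b} = {u, v}"
        and "(x, y) \<in> parcs H \<and> x \<noteq> v \<and> y \<noteq> v \<or> {x, y} = {u, v}"
        using arcs[OF ab] arcs[OF xy] by auto
      then show ?thesis
        using old_old new_old old_new ne by blast
    qed
    have "straight_drawing G g"
      unfolding straight_drawing_def using inj vertices edges by blast
    then show ?thesis
      by blast
  qed
qed

lemma acyclic_imp_planar:
  assumes "pair_graph G" and "acyclic_graph G"
  shows "planar_graph G"
  using straight_drawing_exists[OF assms] pair_graph.straight_drawing_imp_planar[OF assms(1)] by blast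

lemma no_arcs_imp_acyclic: "parcs G = {} \<Longrightarrow> acyclic_graph G"
  by (auto simp: acyclic_graph_def pre_digraph.cycle_def pre_digraph.awalk_def)

theorem proposition1:
  fixes R :: bd_ris
  assumes "bd_ris_architecture R"
  shows "(forest_connected R \<longrightarrow> planar_connected R) \<and>
         (single_connected R \<longrightarrow> forest_connected R \<and> planar_connected R) \<and>
         (tree_connected R \<longrightarrow> forest_connected R \<and> planar_connected R)"
proof -
  have "forest_connected R \<longrightarrow> planar_connected R"
    using assms acyclic_imp_planar
    by (auto simp: bd_ris_architecture_def forest_connected_def planar_connected_def)
  moreover have "single_connected R \<longrightarrow> forest_connected R"
    by (auto simp: single_connected_def forest_connected_def no_arcs_imp_acyclic)
  moreover have "tree_connected R \<longrightarrow> forest_connected R"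
    by (auto simp: tree_connected_def forest_connected_def tree_graph_def)
  ultimately show ?thesis
    by blast
qed

end
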